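(* Let $(X,d)$ be a metric space and let $f:X\to X$ be a map. Assume that $R:X\to X$ is an isometric involution satisfying $R\circ f=f\circ R$. Define the set-valued map $F:X\to 2^X$ by $F(x)=\{f(x),R(f(x))\}$. Then the following assertions hold: (1) If $f$ has the shadowing property, then $F$ has the shadowing property. (2) If $f$ has the periodic shadowing property, then $F$ has the periodic shadowing property. (3) If $f$ is topologically transitive, then $F$ is topologically transitive. (4) If $f$ is chain transitive, then $F$ is chain transitive.
   Context: Here $\mathbb N=\{0,1,2,\dots\}$ and $2^X$ is the family of nonempty compact subsets of $X$. For $x\in X$ and $A\subset X$, $d(x,A)=\inf\{d(x,y): y\in A\}$. No continuity of $f$ is assumed. An isometric involution is a map $R:X\to X$ with $R^2=\mathrm{id}$ and $d(R(x),R(y))=d(x,y)$ for all $x,y\in X$. Notions for a set-valued map $F:X\to 2^X$. An orbit of $F$ is a sequence $\{x_i\}_{i\in\mathbb N}$ with $x_{i+1}\in F(x_i)$ for all $i$. A $\delta$-pseudo-orbit is a sequence $\{x_i\}_{i\in\mathbb N}$ with $d(x_{i+1},F(x_i))<\delta$ for all $i$. A sequence (orbit or pseudo-orbit) $\{x_i\}_{i\in\mathbb N}$ is periodic if there is an integer $m\ge 1$ with $x_{i+m}=x_i$ for all $i\in\mathbb N$. A $\delta$-chain from $x$ to $y$ is a finite sequence $x=x_0,x_1,\dots,x_n=y$, $n\ge 1$, with $d(x_{i+1},F(x_i))<\delta$ for $0\le i\le n-1$. - Shadowing property: for every $\varepsilon>0$ there is $\delta>0$ such that for every $\delta$-pseudo-orbit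 $\{x_i\}_{i\in\mathbb N}$ there is an orbit $\{z_i\}_{i\in\mathbb N}$ with $d(z_i,x_i)<\varepsilon$ for all $i\in\mathbb N$. - Periodic shadowing property: for every $\varepsilon>0$ there is $\delta>0$ such that for every periodic $\delta$-pseudo-orbit $\{x_i\}_{i\in\mathbb N}$ there is a periodic orbit $\{z_i\}_{i\in\mathbb N}$ (not required to have the same period) with $d(z_i,x_i)<\varepsilon$ for all $i\in\mathbb N$. - Topologically transitive: for all nonempty open $U,V\subset X$ there are an orbit $\{x_i\}_{i\in\mathbb N}$ and an integer $n\ge 0$ with $x_0\in U$ and $x_n\in V$. - Chain transitive: for every $\delta>0$ and all $x,y\in X$ there is a $\delta$-chain from $x$ to $y$. The corresponding notions for the single-valued map $f$ are those above applied to $x\mapsto\{f(x)\}$; thus orbits are $\{f^i(x)\}_{i\in\mathbb N}$, pseudo-orbits satisfy $d(f(x_i),x_{i+1})<\delta$ for $i\in\mathbb N$, and transitivity means that for all nonempty open $U,V$ there is $n\ge 0$ with $f^n(U)\cap V\ne\emptyset$. *)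

theory Defs
  imports "HOL-Analysis.Analysis"
begin

text \<open>
  A set-valued map \<open>F : X \<rightarrow> 2\<^sup>X\<close> is a function \<open>'a \<Rightarrow> 'a set\<close>, where \<open>2\<^sup>X\<close> is the family
  \<open>hyperspace\<close> below. The notions for \<open>F\<close> are meant for maps with values in \<open>hyperspace\<close>; in
  particular \<open>infdist\<close>, which the library sets to \<open>0\<close> for the empty set, is then the infimum of
  the distances. The notions for a single-valued map \<open>f\<close> are those for \<open>singleton_map f\<close>.
\<close>

definition hyperspace :: "'a::topological_space set set" where
  "hyperspace = {A. A \<noteq> {} \<and> compact A}"

definition singleton_map :: "('a \<Rightarrow> 'a) \<Rightarrow> 'a \<Rightarrow> 'a set" where
  "singleton_map f = (\<lambda>x. {f x})"

definition isometric_involution :: "('a::metric_space \<Rightarrow> 'a) \<Rightarrow> bool" where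
  "isometric_involution R \<longleftrightarrow> R \<circ> R = id \<and> (\<forall>x y. dist (R x) (R y) = dist x y)"

definition is_orbit :: "('a \<Rightarrow> 'a set) \<Rightarrow> (nat \<Rightarrow> 'a) \<Rightarrow> bool" where
  "is_orbit F x \<longleftrightarrow> (\<forall>i. x (Suc i) \<in> F (x i))"

definition is_pseudo_orbit :: "real \<Rightarrow> ('a::metric_space \<Rightarrow> 'a set) \<Rightarrow> (nat \<Rightarrow> 'a) \<Rightarrow> bool" where
  "is_pseudo_orbit \<delta> F x \<longleftrightarrow> (\<forall>i. infdist (x (Suc i)) (F (x i)) < \<delta>)"

definition is_periodic :: "(nat \<Rightarrow> 'a) \<Rightarrow> bool" where
  "is_periodic x \<longleftrightarrow> (\<exists>m\<ge>1. \<forall>i. x (i + m) = x i)"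

definition is_chain ::
  "real \<Rightarrow> ('a::metric_space \<Rightarrow> 'a set) \<Rightarrow> 'a \<Rightarrow> 'a \<Rightarrow> nat \<Rightarrow> (nat \<Rightarrow> 'a) \<Rightarrow> bool" where
  "is_chain \<delta> F a b n x \<longleftrightarrow>
     n \<ge> 1 \<and> x 0 = a \<and> x n = b \<and> (\<forall>i<n. infdist (x (Suc i)) (F (x i)) < \<delta>)"

definition shadowing_property :: "('a::metric_space \<Rightarrow> 'a set) \<Rightarrow> bool" where
  "shadowing_property F \<longleftrightarrow>
     (\<forall>\<epsilon>>0. \<exists>\<delta>>0. \<forall>x. is_pseudo_orbit \<delta> F x \<longrightarrow>
        (\<exists>z. is_orbit F z \<and> (\<forall>i. dist (z i) (x i) < \<epsilon>)))"

definition periodic_shadowing_property :: "('a::metric_space \<Rightarrow> 'a set) \<Rightarrow> bool" where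
  "periodic_shadowing_property F \<longleftrightarrow>
     (\<forall>\<epsilon>>0. \<exists>\<delta>>0. \<forall>x. is_pseudo_orbit \<delta> F x \<and> is_periodic x \<longrightarrow>
        (\<exists>z. is_orbit F z \<and> is_periodic z \<and> (\<forall>i. dist (z i) (x i) < \<epsilon>)))"

definition topologically_transitive :: "('a::topological_space \<Rightarrow> 'a set) \<Rightarrow> bool" where
  "topologically_transitive F \<longleftrightarrow>
     (\<forall>U V. open U \<and> open V \<and> U \<noteq> {} \<and> V \<noteq> {} \<longrightarrow>
        (\<exists>x n. is_orbit F x \<and> x 0 \<in> U \<and> x n \<in> V))"

definition chain_transitive :: "('a::metric_space \<Rightarrow> 'a set) \<Rightarrow> bool" where
  "chain_transitive F \<longleftrightarrow> (\<forall>\<delta>>0. \<forall>a b. \<exists>n x. is_chain \<delta> F a b n x)"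

lemma singleton_map_in_hyperspace: "singleton_map f x \<in> hyperspace"
  by (simp add: singleton_map_def hyperspace_def)

lemma pair_in_hyperspace: "{a, b} \<in> hyperspace"
  by (simp add: hyperspace_def)

lemma is_orbit_singleton_map: "is_orbit (singleton_map f) x \<longleftrightarrow> (\<forall>i. x i = (f ^^ i) (x 0))"
proof
  assume a: "is_orbit (singleton_map f) x"
  show "\<forall>i. x i = (f ^^ i) (x 0)"
  proof
    fix i show "x i = (f ^^ i) (x 0)"
      using a by (induction i) (auto simp: is_orbit_def singleton_map_def)
  qed
next
  assume a: "\<forall>i. x i = (f ^^ i) (x 0)"
  have "x (Suc i) = f (x i)" for i
    using a[rule_format, of "Suc i"] a[rule_format, of i] by simp
  then show "is_orbit (singleton_map f) x"
    by (simp add: is_orbit_def singleton_map_def)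
qed

lemma is_pseudo_orbit_singleton_map:
  "is_pseudo_orbit \<delta> (singleton_map f) x \<longleftrightarrow> (\<forall>i. dist (f (x i)) (x (Suc i)) < \<delta>)"
  by (simp add: is_pseudo_orbit_def singleton_map_def infdist_def dist_commute)

lemma topologically_transitive_singleton_map:
  "topologically_transitive (singleton_map f) \<longleftrightarrow>
     (\<forall>U V. open U \<and> open V \<and> U \<noteq> {} \<and> V \<noteq> {} \<longrightarrow> (\<exists>n. (f ^^ n) ` U \<inter> V \<noteq> {}))"
proof -
  have "(\<exists>x n. is_orbit (singleton_map f) x \<and> x 0 \<in> U \<and> x n \<in> V) \<longleftrightarrow>
        (\<exists>n. (f ^^ n) ` U \<inter> V \<noteq> {})" for U V
  proof
    assume "\<exists>x n. is_orbit (singleton_map f) x \<and> x 0 \<in> U \<and> x n \<in> V"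
    then obtain x n where "is_orbit (singleton_map f) x" "x 0 \<in> U" "x n \<in> V" by blast
    moreover from this have "x n = (f ^^ n) (x 0)"
      unfolding is_orbit_singleton_map by blast
    ultimately show "\<exists>n. (f ^^ n) ` U \<inter> V \<noteq> {}" by (intro exI[of _ n]) auto
  next
    assume "\<exists>n. (f ^^ n) ` U \<inter> V \<noteq> {}"
    then obtain n u where "u \<in> U" "(f ^^ n) u \<in> V" by blast
    then show "\<exists>x n. is_orbit (singleton_map f) x \<and> x 0 \<in> U \<and> x n \<in> V"
      by (intro exI[of _ "\<lambda>i. (f ^^ i) u"] exI[of _ n])
         (simp add: is_orbit_singleton_map)
  qed
  then show ?thesis by (simp add: topologically_transitive_def)
qed

end

theory Submission
  imports Defs
begin

text \<open>
  A step of an \<open>F\<close>-(pseudo-)orbit is a step of \<open>f\<close>, possibly followed by \<open>R\<close>. Since \<open>R\<close> is an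
  isometry commuting with \<open>f\<close>, the reflections can be accumulated: if \<open>t i\<close> is the parity of the
  number of reflections used before time \<open>i\<close>, then \<open>R\<^bsup>t i\<^esup> (x i)\<close> is a pseudo-orbit of \<open>f\<close>. An
  \<open>f\<close>-orbit \<open>z\<close> that shadows it gives the \<open>F\<close>-orbit \<open>R\<^bsup>t i\<^esup> (z i)\<close>, which shadows \<open>x\<close>. If \<open>x\<close> has
  period \<open>m\<close> and the choice of reflection depends only on \<open>(x i, x (i + 1))\<close>, then \<open>t\<close> has period
  \<open>2 * m\<close>, so periodicity survives. Both transitivity statements hold because \<open>f x \<in> F x\<close>.
\<close>

text \<open>The infimum over two points is a minimum, hence attained by one of them.\<close>

lemma infdist_pair_less_iff:
  "infdist y {a, b} < \<delta> \<longleftrightarrow> dist y a < \<delta> \<or> dist y b < \<delta>"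
  by (simp add: infdist_def cInf_eq_Min min_less_iff_disj)

lemma is_orbit_mono:
  assumes "is_orbit G x" and "\<And>a. G a \<subseteq> F a"
  shows "is_orbit F x"
  using assms unfolding is_orbit_def by blast

text \<open>Enlarging a nonempty set can only decrease \<open>infdist\<close>. An empty
  \<open>G a\<close> would have \<open>infdist\<close> equal to 0, so it must be excluded.\<close>

lemma is_chain_mono:
  assumes "is_chain \<delta> G a b n x" and "\<And>a. G a \<noteq> {}" and "\<And>a. G a \<subseteq> F a"
  shows "is_chain \<delta> F a b n x"
  using assms unfolding is_chain_def by (meson infdist_mono order_le_less_trans)

lemma topologically_transitive_mono:
  assumes "topologically_transitive G" and "\<And>a. G a \<subseteq> F a"
  shows "topologically_transitive F"
  using assms(1) is_orbit_mono[of G _ F, OF _ assms(2)]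
  unfolding topologically_transitive_def by meson

lemma chain_transitive_mono:
  assumes "chain_transitive G" and "\<And>a. G a \<noteq> {}" and "\<And>a. G a \<subseteq> F a"
  shows "chain_transitive F"
  using assms(1) is_chain_mono[of _ G _ _ _ _ F, OF _ assms(2,3)]
  unfolding chain_transitive_def by meson

lemma periodic_add_mult:
  fixes x :: "nat \<Rightarrow> 'a"
  assumes "\<And>i. x (i + m) = x i"
  shows "x (i + k * m) = x i"
proof (induction k)
  case (Suc k)
  have "x (i + Suc k * m) = x ((i + k * m) + m)" by (simp add: algebra_simps)
  with Suc show ?case using assms by simp
qed simp

text \<open>The product of the two periods is a common period.\<close>

lemma is_periodic_map2:
  assumes "is_periodic x" and "is_periodic y"
  shows "is_periodic (\<lambda>i. g (x i) (y i))"
proof -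
  obtain m n where mn: "m \<ge> 1" "n \<ge> 1" "\<And>i. x (i + m) = x i" "\<And>i. y (i + n) = y i"
    using assms unfolding is_periodic_def by blast
  have "x (i + m * n) = x i" "y (i + m * n) = y i" for i
    using periodic_add_mult[of x m i n] periodic_add_mult[of y n i m] mn
    by (simp_all add: mult.commute)
  with mn show ?thesis
    unfolding is_periodic_def by (intro exI[of _ "m * n"]) (simp add: Suc_le_eq)
qed

text \<open>Booleans encode Z/2 with \<open>\<noteq>\<close> as addition; these are the partial sums
  of \<open>s\<close> over indices below \<open>i\<close>.\<close>

primrec parity :: "(nat \<Rightarrow> bool) \<Rightarrow> nat \<Rightarrow> bool" where
  "parity s 0 = False"
| "parity s (Suc i) = (parity s i \<noteq> s i)"

lemma is_periodic_parity:
  assumes "is_periodic s"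
  shows "is_periodic (parity s)"
proof -
  obtain m where m: "m \<ge> 1" "\<And>i. s (i + m) = s i"
    using assms unfolding is_periodic_def by blast
  \<comment> \<open>One period of \<open>s\<close> adds the constant \<open>parity s m\<close>,
    possibly \<open>True\<close>; two periods add it twice, which cancels.\<close>
  have shift: "parity s (i + m) = (parity s i \<noteq> parity s m)" for i
    by (induction i) (use m in auto)
  have "parity s (i + 2 * m) = parity s i" for i
    using shift[of "i + m"] shift[of i] by (auto simp: mult_2 add.assoc)
  with m show ?thesis
    unfolding is_periodic_def by (intro exI[of _ "2 * m"]) simp
qed

context
  fixes f R :: "'a::metric_space \<Rightarrow> 'a"
  assumes inv: "isometric_involution R" and comm: "R \<circ> f = f \<circ> R"
begin

text \<open>The action of Z/2 generated by \<open>R\<close>.\<close>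

definition reflect :: "bool \<Rightarrow> 'a \<Rightarrow> 'a" where
  "reflect b x = (if b then R x else x)"

definition reflection_choice :: "real \<Rightarrow> (nat \<Rightarrow> 'a) \<Rightarrow> nat \<Rightarrow> bool" where
  "reflection_choice \<delta> x i \<longleftrightarrow> \<not> dist (x (Suc i)) (f (x i)) < \<delta>"

lemma reflect_reflect: "reflect a (reflect b x) = reflect (a \<noteq> b) x"
  using inv by (auto simp: reflect_def isometric_involution_def fun_eq_iff)

lemma reflect_reflect_same: "reflect b (reflect b x) = x"
  by (simp add: reflect_reflect) (simp add: reflect_def)

lemma dist_reflect: "dist (reflect b x) (reflect b y) = dist x y"
  using inv by (simp add: reflect_def isometric_involution_def)

lemma reflect_commute: "reflect b (f x) = f (reflect b x)"
  using comm by (simp add: reflect_def fun_eq_iff)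

text \<open>Apply the isometry \<open>reflect b\<close> to both points; on the left it cancels
  itself.\<close>

lemma dist_reflect_left: "dist (reflect b x) y = dist x (reflect b y)"
  using dist_reflect[of b x "reflect b y"] by (simp add: reflect_reflect_same)

lemma reflect_pseudo_orbit:
  assumes "is_pseudo_orbit \<delta> (\<lambda>x. {f x, R (f x)}) x"
  defines "t \<equiv> parity (reflection_choice \<delta> x)"
  shows "is_pseudo_orbit \<delta> (singleton_map f) (\<lambda>i. reflect (t i) (x i))"
  unfolding is_pseudo_orbit_singleton_map
proof
  fix i
  let ?s = "reflection_choice \<delta> x i"
  \<comment> \<open>Since \<open>t (Suc i)\<close> is \<open>t i\<close> plus \<open>?s\<close>, the
    common factor \<open>reflect (t i)\<close> comes out of both points and can then be
    dropped.\<close>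
  have "dist (f (reflect (t i) (x i))) (reflect (t (Suc i)) (x (Suc i)))
      = dist (reflect (t i) (f (x i))) (reflect (t i) (reflect ?s (x (Suc i))))"
    by (simp add: t_def reflect_commute reflect_reflect)
  also have "\<dots> = dist (x (Suc i)) (reflect ?s (f (x i)))"
    using dist_reflect_left[of ?s "x (Suc i)" "f (x i)"] by (simp add: dist_reflect dist_commute)
  \<comment> \<open>If \<open>?s\<close> is false, \<open>f (x i)\<close> is close by the choice
    rule; otherwise \<open>R (f (x i))\<close> must be the close one.\<close>
  also have "\<dots> < \<delta>"
    using assms(1)[unfolded is_pseudo_orbit_def infdist_pair_less_iff]
    by (auto simp: reflect_def reflection_choice_def)
  finally show "dist (f (reflect (t i) (x i))) (reflect (t (Suc i)) (x (Suc i))) < \<delta>" .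
qed

text \<open>Consecutive parities differ by \<open>s i\<close>, so each step applies \<open>f\<close>
  and then at most one \<open>R\<close>.\<close>

lemma reflect_orbit:
  assumes "is_orbit (singleton_map f) z"
  shows "is_orbit (\<lambda>x. {f x, R (f x)}) (\<lambda>i. reflect (parity s i) (z i))"
  unfolding is_orbit_def
proof
  fix i
  have "reflect (parity s (Suc i)) (z (Suc i)) = reflect (s i) (reflect (parity s i) (f (z i)))"
    using assms by (simp add: is_orbit_def singleton_map_def reflect_reflect
        eq_commute[of "s i"])
  also have "\<dots> = reflect (s i) (f (reflect (parity s i) (z i)))"
    by (simp add: reflect_commute)
  finally show "reflect (parity s (Suc i)) (z (Suc i))
      \<in> {f (reflect (parity s i) (z i)), R (f (reflect (parity s i) (z i)))}"
    by (simp add: reflect_def)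
qed

lemma is_periodic_reflection_choice:
  assumes "is_periodic x"
  shows "is_periodic (reflection_choice \<delta> x)"
proof -
  obtain m where m: "m \<ge> 1" "\<And>i. x (i + m) = x i"
    using assms unfolding is_periodic_def by blast
  have "x (Suc (i + m)) = x (Suc i)" for i
    using m(2)[of "Suc i"] by simp
  with m show ?thesis
    unfolding is_periodic_def reflection_choice_def by auto
qed

lemma shadowing_property_reflection:
  assumes "shadowing_property (singleton_map f)"
  shows "shadowing_property (\<lambda>x. {f x, R (f x)})"
  unfolding shadowing_property_def
proof (intro allI impI)
  fix \<epsilon> :: real assume "\<epsilon> > 0"
  then obtain \<delta> where \<delta>: "\<delta> > 0" "\<And>x. is_pseudo_orbit \<delta> (singleton_map f) x \<Longrightarrow>
      \<exists>z. is_orbit (singleton_map f) z \<and> (\<forall>i. dist (z i) (x i) < \<epsilon>)"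
    using assms unfolding shadowing_property_def by meson
  have "\<exists>z. is_orbit (\<lambda>x. {f x, R (f x)}) z \<and> (\<forall>i. dist (z i) (x i) < \<epsilon>)"
    if x: "is_pseudo_orbit \<delta> (\<lambda>x. {f x, R (f x)}) x" for x
  proof -
    let ?t = "parity (reflection_choice \<delta> x)"
    \<comment> \<open>The \<open>\<delta>\<close> for \<open>f\<close> also serves \<open>F\<close>,
      as undoing the reflections keeps the bound on the errors.\<close>
    obtain z where "is_orbit (singleton_map f) z"
        "\<And>i. dist (z i) (reflect (?t i) (x i)) < \<epsilon>"
      using \<delta>(2)[OF reflect_pseudo_orbit[OF x]] by blast
    then show ?thesis
      by (intro exI[of _ "\<lambda>i. reflect (?t i) (z i)"]) (simp add: reflect_orbit dist_reflect_left)
  qed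
  with \<delta>(1) show "\<exists>\<delta>>0. \<forall>x. is_pseudo_orbit \<delta> (\<lambda>x. {f x, R (f x)}) x \<longrightarrow>
      (\<exists>z. is_orbit (\<lambda>x. {f x, R (f x)}) z \<and> (\<forall>i. dist (z i) (x i) < \<epsilon>))" by blast
qed

lemma periodic_shadowing_property_reflection:
  assumes "periodic_shadowing_property (singleton_map f)"
  shows "periodic_shadowing_property (\<lambda>x. {f x, R (f x)})"
  unfolding periodic_shadowing_property_def
proof (intro allI impI)
  fix \<epsilon> :: real assume "\<epsilon> > 0"
  then obtain \<delta> where \<delta>: "\<delta> > 0"
      "\<And>x. is_pseudo_orbit \<delta> (singleton_map f) x \<Longrightarrow> is_periodic x \<Longrightarrow>
        \<exists>z. is_orbit (singleton_map f) z \<and> is_periodic z \<and> (\<forall>i. dist (z i) (x i) < \<epsilon>)"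
    using assms unfolding periodic_shadowing_property_def by meson
  have "\<exists>z. is_orbit (\<lambda>x. {f x, R (f x)}) z \<and> is_periodic z \<and> (\<forall>i. dist (z i) (x i) < \<epsilon>)"
    if x: "is_pseudo_orbit \<delta> (\<lambda>x. {f x, R (f x)}) x" "is_periodic x" for x
  proof -
    let ?t = "parity (reflection_choice \<delta> x)"
    have t: "is_periodic ?t"
      by (intro is_periodic_parity is_periodic_reflection_choice x(2))
    obtain z where "is_orbit (singleton_map f) z" "is_periodic z"
        "\<And>i. dist (z i) (reflect (?t i) (x i)) < \<epsilon>"
      using \<delta>(2)[OF reflect_pseudo_orbit[OF x(1)] is_periodic_map2[OF t x(2)]] by blast
    \<comment> \<open>The periods of \<open>z\<close> and \<open>?t\<close> may be unrelated;
      combining the two sequences is still periodic.\<close>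
    then show ?thesis
      by (intro exI[of _ "\<lambda>i. reflect (?t i) (z i)"])
         (simp add: reflect_orbit dist_reflect_left is_periodic_map2[OF t])
  qed
  with \<delta>(1) show "\<exists>\<delta>>0. \<forall>x. is_pseudo_orbit \<delta> (\<lambda>x. {f x, R (f x)}) x \<and> is_periodic x \<longrightarrow>
      (\<exists>z. is_orbit (\<lambda>x. {f x, R (f x)}) z \<and> is_periodic z \<and> (\<forall>i. dist (z i) (x i) < \<epsilon>))"
    by blast
qed

end

theorem theorem3p2:
  fixes f R :: "'a::metric_space \<Rightarrow> 'a" and F :: "'a \<Rightarrow> 'a set"
  assumes "isometric_involution R"
    and "R \<circ> f = f \<circ> R"
    and "F = (\<lambda>x. {f x, R (f x)})"
  shows "(shadowing_property (singleton_map f) \<longrightarrow> shadowing_property F) \<and>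
         (periodic_shadowing_property (singleton_map f) \<longrightarrow> periodic_shadowing_property F) \<and>
         (topologically_transitive (singleton_map f) \<longrightarrow> topologically_transitive F) \<and>
         (chain_transitive (singleton_map f) \<longrightarrow> chain_transitive F)"
proof -
  have "singleton_map f x \<noteq> {}" "singleton_map f x \<subseteq> F x" for x
    by (simp_all add: assms(3) singleton_map_def)
  then show ?thesis
    using shadowing_property_reflection[OF assms(1,2)]
      periodic_shadowing_property_reflection[OF assms(1,2)]
      topologically_transitive_mono[of "singleton_map f" F]
      chain_transitive_mono[of "singleton_map f" F]
    by (simp add: assms(3))
qed

end
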